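(* Let $G=(V,E)$ be a finite simple graph with minimum degree at least $2$, and let $r\in\mathbb{N}$. Then there exists a vertex $v\in V$ such that \[ \lambda_1(\tilde{G}(v,r)) \ge \frac{1}{|E|}\sum_{u\in V} d(u)\sqrt{d(u)-1}\cdot \cos\left(\frac{\pi}{r+2}\right). \]
   Context: $d(u)$ denotes the degree of $u$ in $G$, and $\lambda_1(H)$ denotes the spectral radius (largest eigenvalue) of the adjacency matrix of a graph $H$. A walk $(v_0,v_1,\dots)$ in $G$ is non-backtracking if $v_i\neq v_{i+2}$ for all $i$. For a vertex $v$ and $r\in\mathbb{N}$, the unraveled ball $\tilde{G}(v,r)$ is the tree whose vertices are all non-backtracking walks in $G$ of length at most $r$ starting at $v$ (including the walk $(v)$ of length $0$), two such walks being adjacent if and only if one is obtained from the other by appending one vertex; equivalently, it is the ball of radius $r$ around $v$ in the universal cover of $G$. *)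

theory Defs
  imports "Jordan_Normal_Form.Spectral_Radius"
begin

text \<open>A graph is a pair of a vertex set and a set of undirected edges, an edge being the
  two-element set of its endpoints.\<close>

type_synonym 'a ugraph = "'a set \<times> 'a set set"

definition finite_simple_graph :: "'a ugraph \<Rightarrow> bool" where
  "finite_simple_graph G \<longleftrightarrow>
     finite (fst G) \<and> fst G \<noteq> {} \<and> (\<forall>e\<in>snd G. e \<subseteq> fst G \<and> card e = 2)"

definition vertex_degree :: "'a ugraph \<Rightarrow> 'a \<Rightarrow> nat" where
  "vertex_degree G u = card {w \<in> fst G. {u, w} \<in> snd G}"

text \<open>Row and column \<open>i\<close> of the matrix belong to the \<open>i\<close>-th vertex of the enumeration \<open>xs\<close>.
  There are no loops, so the diagonal is zero. The entries are complex because
  \<^const>\<open>spectral_radius\<close> is defined for complex matrices.\<close>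

definition adjacency_matrix :: "'a ugraph \<Rightarrow> 'a list \<Rightarrow> complex mat" where
  "adjacency_matrix G xs =
     mat (length xs) (length xs) (\<lambda>(i, j). if {xs ! i, xs ! j} \<in> snd G then 1 else 0)"

definition lambda1 :: "'a ugraph \<Rightarrow> real" where
  "lambda1 G =
     spectral_radius (adjacency_matrix G (SOME xs. distinct xs \<and> set xs = fst G))"

text \<open>The choice of the enumeration is immaterial: the eigenvalues can be described without
  it.\<close>

lemma eigenvalue_adjacency_matrix_iff:
  assumes "distinct xs"
  shows "eigenvalue (adjacency_matrix G xs) k \<longleftrightarrow>
    (\<exists>f. (\<exists>x\<in>set xs. f x \<noteq> 0) \<and>
         (\<forall>x\<in>set xs. (\<Sum>y\<in>{y \<in> set xs. {x, y} \<in> snd G}. f y) = k * f x))"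
proof -
  define n where "n = length xs"
  let ?A = "adjacency_matrix G xs"
  have entry: "(?A *\<^sub>v vec n (\<lambda>i. f (xs ! i))) $ i
      = (\<Sum>y\<in>{y \<in> set xs. {xs ! i, y} \<in> snd G}. f y)"
    if i: "i < n" for f i
  proof -
    have "(?A *\<^sub>v vec n (\<lambda>i. f (xs ! i))) $ i
        = (\<Sum>j<n. if {xs ! i, xs ! j} \<in> snd G then f (xs ! j) else 0)"
      using i by (auto simp: adjacency_matrix_def n_def scalar_prod_def atLeast0LessThan
          intro!: sum.cong)
    also have "\<dots> = (\<Sum>y\<in>set xs. if {xs ! i, y} \<in> snd G then f y else 0)"
      by (rule sum.reindex_bij_betw[OF bij_betw_nth]) (use assms in \<open>auto simp: n_def\<close>)
    also have "\<dots> = (\<Sum>y\<in>{y \<in> set xs. {xs ! i, y} \<in> snd G}. f y)"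
      by (rule sum.inter_filter[symmetric]) simp
    finally show ?thesis .
  qed
  have vec_iff: "eigenvector ?A (vec n (\<lambda>i. f (xs ! i))) k \<longleftrightarrow>
      (\<exists>x\<in>set xs. f x \<noteq> 0) \<and>
      (\<forall>x\<in>set xs. (\<Sum>y\<in>{y \<in> set xs. {x, y} \<in> snd G}. f y) = k * f x)" (is "?L \<longleftrightarrow> ?R") for f
  proof -
    let ?v = "vec n (\<lambda>i. f (xs ! i))"
    have dim: "dim_row ?A = n" by (simp add: adjacency_matrix_def n_def)
    have "?v \<noteq> 0\<^sub>v n \<longleftrightarrow> (\<exists>x\<in>set xs. f x \<noteq> 0)"
      by (auto simp: vec_eq_iff set_conv_nth n_def)
    moreover have "?A *\<^sub>v ?v = k \<cdot>\<^sub>v ?v \<longleftrightarrow>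
        (\<forall>i<n. (\<Sum>y\<in>{y \<in> set xs. {xs ! i, y} \<in> snd G}. f y) = k * f (xs ! i))"
      using entry dim by (auto simp: vec_eq_iff simp del: index_mult_mat_vec)
    ultimately show ?thesis
      unfolding eigenvector_def dim by (auto simp: all_set_conv_all_nth n_def)
  qed
  show ?thesis
  proof
    assume "eigenvalue ?A k"
    then obtain v where v: "eigenvector ?A v k" by (auto simp: eigenvalue_def)
    define f where "f x = v $ (THE i. i < n \<and> xs ! i = x)" for x
    have f: "f (xs ! i) = v $ i" if "i < n" for i
    proof -
      have "(THE j. j < n \<and> xs ! j = xs ! i) = i"
        using that assms by (auto simp: n_def nth_eq_iff_index_eq)
      then show ?thesis by (simp add: f_def)
    qed
    have "v = vec n (\<lambda>i. f (xs ! i))"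
      using v f by (auto simp: eigenvector_def adjacency_matrix_def n_def vec_eq_iff)
    with v vec_iff[of f] show "\<exists>f. (\<exists>x\<in>set xs. f x \<noteq> 0) \<and>
         (\<forall>x\<in>set xs. (\<Sum>y\<in>{y \<in> set xs. {x, y} \<in> snd G}. f y) = k * f x)" by auto
  next
    assume "\<exists>f. (\<exists>x\<in>set xs. f x \<noteq> 0) \<and>
         (\<forall>x\<in>set xs. (\<Sum>y\<in>{y \<in> set xs. {x, y} \<in> snd G}. f y) = k * f x)"
    then show "eigenvalue ?A k" using vec_iff by (auto simp: eigenvalue_def)
  qed
qed

lemma lambda1_eq:
  assumes "distinct xs" "set xs = fst G"
  shows "lambda1 G = spectral_radius (adjacency_matrix G xs)"
proof -
  define ys where "ys = (SOME xs. distinct xs \<and> set xs = fst G)"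
  have ys: "distinct ys \<and> set ys = fst G"
    unfolding ys_def by (rule someI) (use assms in blast)
  have "eigenvalue (adjacency_matrix G ys) k \<longleftrightarrow> eigenvalue (adjacency_matrix G xs) k" for k
    using ys assms by (simp add: eigenvalue_adjacency_matrix_iff)
  then have "eigenvalue (adjacency_matrix G ys) = eigenvalue (adjacency_matrix G xs)"
    by (rule ext)
  then show ?thesis
    by (simp add: lambda1_def ys_def[symmetric] spectral_radius_def spectrum_def)
qed

definition nonbacktracking_walk :: "'a ugraph \<Rightarrow> 'a list \<Rightarrow> bool" where
  "nonbacktracking_walk G p \<longleftrightarrow>
     p \<noteq> [] \<and> set p \<subseteq> fst G \<and>
     (\<forall>i. i + 1 < length p \<longrightarrow> {p ! i, p ! (i + 1)} \<in> snd G) \<and>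
     (\<forall>i. i + 2 < length p \<longrightarrow> p ! i \<noteq> p ! (i + 2))"

text \<open>A walk is the list of its vertices, so a walk of length \<open>k\<close> is a list with \<open>k + 1\<close>
  entries.\<close>

definition unraveled_ball :: "'a ugraph \<Rightarrow> 'a \<Rightarrow> nat \<Rightarrow> 'a list ugraph" where
  "unraveled_ball G v r =
     (let W = {p. nonbacktracking_walk G p \<and> hd p = v \<and> length p \<le> r + 1}
      in (W, {{p, p @ [u]} | p u. p \<in> W \<and> p @ [u] \<in> W}))"

end

theory Submission
  imports Defs "HOL-Analysis.Function_Topology"
begin

text \<open>Let a random non-backtracking walk start at a vertex chosen proportionally to its degree. Each of
  its steps then traverses a uniformly distributed directed edge. On the unraveled ball around \<open>v\<close> take
  the test function \<open>f p = sin ((k + 1) \<pi> / (r + 2)) sqrt (weight p)\<close> at a walk \<open>p\<close> of length \<open>k\<close>, where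
  \<open>weight p\<close> is proportional to the probability of \<open>p\<close>; the sines form the Perron eigenvector of the
  path with \<open>r + 1\<close> vertices. By stationarity the quadratic forms and the squared norms, each summed
  over all centres \<open>v\<close>, are respectively at least
  \<open>2 cos (\<pi> / (r + 2)) P (\<Sum>u. d u sqrt (d u - 1))\<close> and exactly \<open>2 |E| P\<close>, where \<open>P\<close> is the squared norm
  of that eigenvector. Hence some centre attains the averaged Rayleigh quotient.\<close>

subsection \<open>The Rayleigh bound\<close>

text \<open>For small \<open>t\<close> of the same sign as \<open>b\<close> the linear term
  dominates. This serves as the first-order condition at a maximum.\<close>

lemma linear_coeff_zero_if_nonpos:
  fixes b c :: real
  assumes "\<And>t. 2 * t * b + t\<^sup>2 * c \<le> 0"
  shows "b = 0"
proof (rule ccontr)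
  assume b: "b \<noteq> 0"
  \<comment> \<open>At this scale \<open>e * \<bar>c\<bar> < 1\<close>, so for
    \<open>t = e * b\<close> the quadratic term cannot outweigh the linear one.\<close>
  define e where "e = 1 / (1 + \<bar>c\<bar>)"
  have e: "e > 0" by (simp add: e_def add_pos_nonneg)
  have "e * c > - 2"
    by (simp add: e_def field_simps add_pos_nonneg)
  then have "e * b\<^sup>2 * (2 + e * c) > 0" using e b by (intro mult_pos_pos) auto
  moreover have "2 * (e * b) * b + (e * b)\<^sup>2 * c = e * b\<^sup>2 * (2 + e * c)"
    by (simp add: power2_eq_square algebra_simps)
  ultimately show False using assms[of "e * b"] by linarith
qed

text \<open>Compactness of the unit sphere yields a maximizer of the Rayleigh quotient; varying one
  coordinate at a time shows that it is an eigenvector whose eigenvalue is the maximum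
  \<open>M\<close>.\<close>

lemma symmetric_form_maximizer:
  fixes a :: "'b \<Rightarrow> 'b \<Rightarrow> real"
  assumes fin: "finite X" and ne: "X \<noteq> {}"
    and sym: "\<And>x y. x \<in> X \<Longrightarrow> y \<in> X \<Longrightarrow> a x y = a y x"
  obtains f M where "\<exists>x\<in>X. f x \<noteq> 0"
    and "\<And>x. x \<in> X \<Longrightarrow> (\<Sum>y\<in>X. a x y * f y) = M * f x"
    and "\<And>g. (\<Sum>x\<in>X. \<Sum>y\<in>X. a x y * (g x * g y)) \<le> M * (\<Sum>x\<in>X. (g x)\<^sup>2)"
proof -
  define Q where "Q g = (\<Sum>x\<in>X. \<Sum>y\<in>X. a x y * (g x * g y))" for g :: "'b \<Rightarrow> real"
  define N where "N g = (\<Sum>x\<in>X. (g x)\<^sup>2)" for g :: "'b \<Rightarrow> real"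
  \<comment> \<open>Functions live on the whole type, so they are pinned to 0 outside
    \<open>X\<close>. Tychonoff's theorem makes the box compact, and \<open>K\<close> is a copy of
    the unit sphere of the real functions on \<open>X\<close>.\<close>
  define B where "B = PiE UNIV (\<lambda>x. if x \<in> X then {-1..1} else {0::real})"
  define K where "K = B \<inter> {g. N g = 1}"
  have "compactin (product_topology (\<lambda>_. euclidean) UNIV) B"
    unfolding B_def by (subst compactin_PiE) auto
  then have "compact B" by (simp add: euclidean_product_topology)
  moreover have "closed {g. N g = 1}"
    unfolding N_def by (intro closed_Collect_eq continuous_intros continuous_on_product_coordinates)
  ultimately have "compact K" unfolding K_def by (rule compact_Int_closed)
  have contQ: "continuous_on K Q"
    unfolding Q_def
    by (intro continuous_intros continuous_on_product_then_coordinatewise continuous_on_id)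
  have normalize: "(\<lambda>x. if x \<in> X then g x / sqrt (N g) else 0) \<in> K" (is "?h \<in> K")
    if "N g > 0" for g
  proof -
    have "N ?h = (\<Sum>x\<in>X. (g x)\<^sup>2 / N g)"
      unfolding N_def[of ?h] using that
      by (intro sum.cong) (auto simp: power_divide)
    also have "\<dots> = 1" using that by (simp add: sum_divide_distrib[symmetric] N_def)
    finally have N1: "N ?h = 1" .
    have "?h x \<in> (if x \<in> X then {-1..1} else {0})" for x
    proof (cases "x \<in> X")
      case True
      have "(?h x)\<^sup>2 \<le> N ?h" unfolding N_def by (rule member_le_sum) (use True fin in auto)
      then have "\<bar>?h x\<bar> \<le> 1" unfolding N1 by (simp only: abs_square_le_1)
      then show ?thesis unfolding if_P[OF True] atLeastAtMost_iff by linarith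
    qed simp
    then have "?h \<in> B" unfolding B_def by (intro PiE_I) simp_all
    with N1 show ?thesis by (simp add: K_def)
  qed
  have "N (\<lambda>_. 1) > 0" using fin ne by (simp add: N_def card_gt_0_iff)
  from normalize[OF this] have "K \<noteq> {}" by blast
  from continuous_attains_sup[OF \<open>compact K\<close> this contQ]
  obtain f where f: "f \<in> K" and max: "\<And>g. g \<in> K \<Longrightarrow> Q g \<le> Q f" by auto
  define M where "M = Q f"
  have Nf: "N f = 1" using f by (simp add: K_def)
  have bound: "Q g \<le> M * N g" for g
  proof (cases "N g = 0")
    case True
    then have "\<forall>x\<in>X. g x = 0" using fin by (simp add: N_def sum_nonneg_eq_0_iff)
    then show ?thesis using True by (simp add: Q_def)
  next
    case False
    moreover have "N g \<ge> 0" by (simp add: N_def sum_nonneg)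
    ultimately have pos: "N g > 0" by simp
    define h where "h = (\<lambda>x. if x \<in> X then g x / sqrt (N g) else 0)"
    have "Q h = (\<Sum>x\<in>X. \<Sum>y\<in>X. a x y * (g x * g y) / N g)"
      unfolding Q_def h_def using pos by (intro sum.cong) auto
    also have "\<dots> = Q g / N g" by (simp add: sum_divide_distrib[symmetric] Q_def)
    finally have "Q g = Q h * N g" using pos by simp
    also have "\<dots> \<le> M * N g"
      unfolding M_def using max[OF normalize[OF pos]] pos
      by (intro mult_right_mono) (simp_all add: h_def)
    finally show ?thesis .
  qed
  have stationary: "(\<Sum>y\<in>X. a x y * f y) = M * f x" if x: "x \<in> X" for x
  proof -
    define L where "L = (\<Sum>y\<in>X. a x y * f y)"
    \<comment> \<open>This is \<open>bound\<close> for \<open>f\<close> with \<open>t\<close> added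
      at the single coordinate \<open>x\<close>, after cancelling \<open>Q f = M\<close> against
      \<open>M * N f\<close>. Symmetry of \<open>a\<close> merges the two cross terms.\<close>
    have "2 * t * (L - M * f x) + t\<^sup>2 * (a x x - M) \<le> 0" for t
    proof -
      define e where "e y = (if y = x then t else 0)" for y
      have L': "(\<Sum>y\<in>X. a y x * f y) = L" unfolding L_def using sym x by (intro sum.cong) auto
      have delta: "(\<Sum>y\<in>X. k y * e y) = k x * t" for k
        using x fin by (simp add: e_def if_distrib[of "(*) _"] sum.delta cong: if_cong)
      have "Q (\<lambda>y. f y + e y) = Q f + (\<Sum>z\<in>X. \<Sum>y\<in>X. (a z y * f z) * e y)
          + (\<Sum>z\<in>X. (\<Sum>y\<in>X. a z y * f y) * e z) + (\<Sum>z\<in>X. (\<Sum>y\<in>X. a z y * e y) * e z)"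
        unfolding Q_def sum.distrib[symmetric] sum_distrib_right
        by (intro sum.cong refl) (simp add: algebra_simps)
      also have "\<dots> = Q f + 2 * t * L + t\<^sup>2 * a x x"
        unfolding delta sum_distrib_right[symmetric] L' L_def[symmetric]
        by (simp add: power2_eq_square)
      finally have q: "Q (\<lambda>y. f y + e y) = M + 2 * t * L + t\<^sup>2 * a x x" by (simp add: M_def)
      have "N (\<lambda>y. f y + e y) = N f + (\<Sum>y\<in>X. if y = x then 2 * f y * t + t\<^sup>2 else 0)"
        unfolding N_def sum.distrib[symmetric]
        by (intro sum.cong refl) (auto simp: e_def power2_eq_square algebra_simps)
      also have "\<dots> = 1 + 2 * f x * t + t\<^sup>2" using x fin Nf by (simp add: sum.delta)
      finally show ?thesis using bound[of "\<lambda>y. f y + e y"] q by (simp add: algebra_simps)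
    qed
    from linear_coeff_zero_if_nonpos[OF this] show ?thesis by (simp add: L_def)
  qed
  have "\<exists>x\<in>X. f x \<noteq> 0" using Nf by (auto simp: N_def intro: ccontr)
  from that[OF this stationary] bound show ?thesis by (simp add: Q_def N_def)
qed

text \<open>The maximal Rayleigh quotient \<open>M\<close> is an eigenvalue of the adjacency matrix,
  so \<open>c \<le> M \<le> \<bar>M\<bar>\<close>, and the spectral radius bounds
  \<open>\<bar>M\<bar>\<close>. Summing over ordered pairs counts each edge twice, as the matrix
  form does.\<close>

lemma lambda1_ge_Rayleigh_quotient:
  fixes g :: "'b \<Rightarrow> real"
  assumes fin: "finite (fst H)"
    and pos: "(\<Sum>x\<in>fst H. (g x)\<^sup>2) > 0"
    and le: "c * (\<Sum>x\<in>fst H. (g x)\<^sup>2)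
      \<le> (\<Sum>(x, y)\<in>{(x, y). x \<in> fst H \<and> y \<in> fst H \<and> {x, y} \<in> snd H}. g x * g y)"
  shows "c \<le> lambda1 H"
proof -
  define X where "X = fst H"
  define a where "a x y = (if {x, y} \<in> snd H then 1 else 0 :: real)" for x y
  have [simp]: "finite X" using fin by (simp add: X_def)
  have ne: "X \<noteq> {}" using pos by (auto simp: X_def)
  obtain f M where f0: "\<exists>x\<in>X. f x \<noteq> 0"
    and eig: "\<And>x. x \<in> X \<Longrightarrow> (\<Sum>y\<in>X. a x y * f y) = M * f x"
    and bound: "\<And>g. (\<Sum>x\<in>X. \<Sum>y\<in>X. a x y * (g x * g y)) \<le> M * (\<Sum>x\<in>X. (g x)\<^sup>2)"
    by (rule symmetric_form_maximizer[of X a])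
      (use ne in \<open>auto simp: a_def insert_commute\<close>)
  have "(\<Sum>(x, y)\<in>{(x, y). x \<in> X \<and> y \<in> X \<and> {x, y} \<in> snd H}. g x * g y)
      = (\<Sum>(x, y)\<in>X \<times> X. a x y * (g x * g y))"
    by (rule sum.mono_neutral_cong_left) (auto simp: a_def, meson)
  also have "\<dots> = (\<Sum>x\<in>X. \<Sum>y\<in>X. a x y * (g x * g y))" by (simp add: sum.cartesian_product)
  finally have "c * (\<Sum>x\<in>X. (g x)\<^sup>2) \<le> M * (\<Sum>x\<in>X. (g x)\<^sup>2)"
    using le bound[of g] by (simp add: X_def)
  then have cM: "c \<le> M" using pos by (simp add: X_def)
  obtain xs where xs: "distinct xs" "set xs = X"
    using finite_distinct_list[of X] by auto
  define A where "A = adjacency_matrix H xs"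
  have A: "A \<in> carrier_mat (length xs) (length xs)" by (simp add: A_def adjacency_matrix_def)
  have len: "length xs > 0" using ne xs by auto
  have "eigenvalue A (complex_of_real M)"
    unfolding A_def eigenvalue_adjacency_matrix_iff[OF xs(1)] xs(2)
  proof (intro exI conjI ballI)
    show "\<exists>x\<in>X. complex_of_real (f x) \<noteq> 0" using f0 by simp
    fix x assume x: "x \<in> X"
    have "(\<Sum>y\<in>{y \<in> X. {x, y} \<in> snd H}. f y) = (\<Sum>y\<in>X. a x y * f y)"
      by (rule sum.mono_neutral_cong_left) (auto simp: a_def)
    also have "\<dots> = M * f x" by (rule eig[OF x])
    finally have "complex_of_real (\<Sum>y\<in>{y \<in> X. {x, y} \<in> snd H}. f y)
        = complex_of_real (M * f x)" by (rule arg_cong)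
    then show "(\<Sum>y\<in>{y \<in> X. {x, y} \<in> snd H}. complex_of_real (f y))
        = complex_of_real M * complex_of_real (f x)" by simp
  qed
  then have "norm (complex_of_real M) \<in> norm ` spectrum A"
    by (intro imageI) (simp add: spectrum_def)
  from spectral_radius_mem_max(2)[OF A len this] have "\<bar>M\<bar> \<le> spectral_radius A" by simp
  moreover have "lambda1 H = spectral_radius A"
    unfolding A_def by (rule lambda1_eq) (use xs in \<open>auto simp: X_def\<close>)
  ultimately show ?thesis using cM by linarith
qed

text \<open>The identity \<open>2 cos t sin (j t) = sin ((j - 1) t) + sin ((j + 1) t)\<close> is the
  eigenvalue equation of a path, with the zeros at \<open>j = 0\<close> and \<open>j = r + 2\<close>
  as boundary conditions. Pairing it with the vector itself gives the quadratic form.\<close>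

lemma sin_path_eigenvector:
  fixes r :: nat
  defines "s j \<equiv> sin (real j * (pi / (real r + 2)))"
  shows "(\<Sum>k<r. 2 * (s (k + 1) * s (k + 2)))
    = 2 * cos (pi / (real r + 2)) * (\<Sum>k\<le>r. (s (k + 1))\<^sup>2)"
proof -
  define t where "t = pi / (real r + 2)"
  have rec: "2 * cos t * s (k + 1) = s k + s (k + 2)" for k
    unfolding s_def t_def[symmetric]
    using sin_times_cos[of "real (k + 1) * t" t] by (simp add: algebra_simps)
  have "real (r + 2) * (pi / (real r + 2)) = pi" by (simp add: add_eq_0_iff add.commute)
  then have "s (r + 2) = 0" by (simp add: s_def)
  have "2 * cos t * (\<Sum>k\<le>r. (s (k + 1))\<^sup>2) = (\<Sum>k\<le>r. s (k + 1) * (2 * cos t * s (k + 1)))"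
    by (simp add: sum_distrib_left power2_eq_square mult_ac)
  also have "\<dots> = (\<Sum>k\<le>r. s (k + 1) * s k) + (\<Sum>k\<le>r. s (k + 1) * s (k + 2))"
    unfolding rec by (simp add: algebra_simps sum.distrib)
  \<comment> \<open>The two sums agree after an index shift: here the term with
    \<open>s 0 = 0\<close> drops out, below the one with \<open>s (r + 2) = 0\<close>.\<close>
  also have "(\<Sum>k\<le>r. s (k + 1) * s k) = (\<Sum>k<r. s (k + 1) * s (k + 2))"
    by (subst sum.atMost_shift) (simp add: s_def[of 0] mult.commute)
  also have "(\<Sum>k\<le>r. s (k + 1) * s (k + 2)) = (\<Sum>k<r. s (k + 1) * s (k + 2))"
    using \<open>s (r + 2) = 0\<close> by (simp add: lessThan_Suc_atMost[symmetric])
  finally show ?thesis by (simp add: t_def sum_distrib_left sum.distrib[symmetric])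
qed

subsection \<open>Random non-backtracking walks\<close>

locale min_degree_2_graph =
  fixes V :: "'a set" and E :: "'a set set"
  assumes graph: "finite_simple_graph (V, E)"
    and degree_ge_2: "\<And>u. u \<in> V \<Longrightarrow> vertex_degree (V, E) u \<ge> 2"
begin

abbreviation d :: "'a \<Rightarrow> nat" where "d \<equiv> vertex_degree (V, E)"

definition nbrs :: "'a \<Rightarrow> 'a set" where
  "nbrs a = {b \<in> V. {a, b} \<in> E}"

definition walks :: "nat \<Rightarrow> 'a list set" where
  "walks k = {p. nonbacktracking_walk (V, E) p \<and> length p = k + 1}"

text \<open>A one-vertex walk has no edge to reverse, so all neighbours of its vertex
  qualify.\<close>

definition extensions :: "'a list \<Rightarrow> 'a set" where
  "extensions p = {u \<in> nbrs (last p). 2 \<le> length p \<longrightarrow> u \<noteq> p ! (length p - 2)}"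

text \<open>Up to normalization, \<open>weight p\<close> is the probability that \<open>p\<close> is the trajectory of the
  random walk which starts at a vertex chosen proportionally to its degree and then moves uniformly
  among the non-backtracking continuations.\<close>

definition weight :: "'a list \<Rightarrow> real" where
  "weight p = real (d (hd p)) / (\<Prod>i<length p - 1. real (card (extensions (take (i + 1) p))))"

section \<open>Neighbourhoods and the degree sum\<close>

lemma finite_V [simp]: "finite V"
  and V_nonempty: "V \<noteq> {}"
  using graph by (auto simp: finite_simple_graph_def)

lemma finite_nbrs [simp]: "finite (nbrs a)"
  by (simp add: nbrs_def)

lemma finite_extensions [simp]: "finite (extensions p)"
  by (simp add: extensions_def)

lemma d_eq: "d u = card (nbrs u)"
  by (simp add: vertex_degree_def nbrs_def)

lemma sum_nbrs_swap:
  "(\<Sum>a\<in>V. \<Sum>b\<in>nbrs a. h a b) = (\<Sum>b\<in>V. \<Sum>a\<in>nbrs b. h a b)"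
  for h :: "'a \<Rightarrow> 'a \<Rightarrow> real"
  unfolding nbrs_def
  using sum.swap_restrict[OF finite_V finite_V, of h "\<lambda>a b. {a, b} \<in> E"]
  by (simp add: insert_commute)

text \<open>Double counting of incidences between vertices and edges; this brings
  \<open>card E\<close> into the bound.\<close>

lemma sum_degrees: "(\<Sum>u\<in>V. real (d u)) = 2 * real (card E)"
proof -
  have E: "e \<subseteq> V" "card e = 2" if "e \<in> E" for e
    using graph that by (auto simp: finite_simple_graph_def)
  have finE: "finite E" by (rule finite_subset[of _ "Pow V"]) (use E in auto)
  have "d u = card {e \<in> E. u \<in> e}" if "u \<in> V" for u
  proof -
    have "bij_betw (\<lambda>b. {u, b}) (nbrs u) {e \<in> E. u \<in> e}"
    proof (rule bij_betwI')
      fix b b' show "({u, b} = {u, b'}) = (b = b')" by (auto simp: doubleton_eq_iff)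
    next
      fix b assume "b \<in> nbrs u" then show "{u, b} \<in> {e \<in> E. u \<in> e}" by (simp add: nbrs_def)
    next
      fix e assume "e \<in> {e \<in> E. u \<in> e}"
      then have e: "e \<in> E" "u \<in> e" by auto
      then obtain b where "e = {u, b}" using E(2)[of e] by (auto simp: card_2_iff)
      then show "\<exists>b\<in>nbrs u. e = {u, b}" using e E(1)[of e] by (auto simp: nbrs_def)
    qed
    then show ?thesis by (simp add: d_eq bij_betw_same_card)
  qed
  then have "(\<Sum>u\<in>V. d u) = (\<Sum>u\<in>V. card {e \<in> E. u \<in> e})" by simp
  also have "\<dots> = (\<Sum>e\<in>E. card {u \<in> V. u \<in> e})"
    using sum.swap_restrict[OF finite_V finE, of "\<lambda>_ _. 1 :: nat" "\<lambda>u e. u \<in> e"] by simp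
  also have "\<dots> = (\<Sum>e\<in>E. 2)"
  proof (rule sum.cong)
    fix e assume e: "e \<in> E"
    then have "{u \<in> V. u \<in> e} = e" using E(1) by auto
    then show "card {u \<in> V. u \<in> e} = 2" using E(2) e by simp
  qed simp
  finally have "(\<Sum>u\<in>V. d u) = 2 * card E" by simp
  then show ?thesis by (metis of_nat_mult of_nat_numeral of_nat_sum)
qed

section \<open>Non-backtracking walks built by appending a vertex\<close>

lemma nonbacktracking_walk_snoc:
  assumes "p \<noteq> []"
  shows "nonbacktracking_walk (V, E) (p @ [u]) \<longleftrightarrow> nonbacktracking_walk (V, E) p \<and> u \<in> extensions p"
proof -
  have steps: "(\<forall>i. i + 1 < length (p @ [u]) \<longrightarrow> P ((p @ [u]) ! i) ((p @ [u]) ! (i + 1)))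
      \<longleftrightarrow> (\<forall>i. i + 1 < length p \<longrightarrow> P (p ! i) (p ! (i + 1))) \<and> P (last p) u" for P
  proof -
    obtain n where n: "length p = Suc n" using assms by (cases p) auto
    have "(\<forall>i. i + 1 < length (p @ [u]) \<longrightarrow> P ((p @ [u]) ! i) ((p @ [u]) ! (i + 1)))
      \<longleftrightarrow> (\<forall>i<n. P (p ! i) (p ! (i + 1))) \<and> P (p ! n) u"
      by (auto simp: n nth_append less_Suc_eq) (metis Suc_lessI)
    then show ?thesis using n assms by (simp add: last_conv_nth)
  qed
  \<comment> \<open>Appending \<open>u\<close> creates a single new turn, at \<open>last p\<close>,
    and only if \<open>p\<close> already has an edge.\<close>
  have turns: "(\<forall>i. i + 2 < length (p @ [u]) \<longrightarrow> (p @ [u]) ! i \<noteq> (p @ [u]) ! (i + 2))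
      \<longleftrightarrow> (\<forall>i. i + 2 < length p \<longrightarrow> p ! i \<noteq> p ! (i + 2))
        \<and> (2 \<le> length p \<longrightarrow> u \<noteq> p ! (length p - 2))"
  proof (cases "2 \<le> length p")
    case True
    then obtain n where n: "length p = Suc (Suc n)" by (metis add_2_eq_Suc le_Suc_ex)
    have "(\<forall>i. i + 2 < length (p @ [u]) \<longrightarrow> (p @ [u]) ! i \<noteq> (p @ [u]) ! (i + 2))
      \<longleftrightarrow> (\<forall>i<n. p ! i \<noteq> p ! (i + 2)) \<and> p ! n \<noteq> u"
      by (auto simp: n nth_append less_Suc_eq) (metis Suc_lessI)
    then show ?thesis using n by auto
  qed auto
  show ?thesis
    unfolding nonbacktracking_walk_def extensions_def nbrs_def fst_conv snd_conv
      steps[of "\<lambda>x y. {x, y} \<in> E"] turns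
    using assms by auto
qed

lemma walks_0: "walks 0 = (\<lambda>v. [v]) ` V"
  by (auto simp: walks_def nonbacktracking_walk_def length_Suc_conv)

lemma walks_Suc: "walks (Suc k) = (\<lambda>(p, u). p @ [u]) ` (SIGMA p:walks k. extensions p)"
proof (intro equalityI subsetI)
  fix q assume q: "q \<in> walks (Suc k)"
  then have ne: "q \<noteq> []" "butlast q \<noteq> []" by (auto simp: walks_def butlast_conv_take)
  have "nonbacktracking_walk (V, E) (butlast q @ [last q])"
    using q ne by (simp add: walks_def)
  then have "(butlast q, last q) \<in> (SIGMA p:walks k. extensions p)"
    using q ne(2) nonbacktracking_walk_snoc by (simp add: walks_def)
  then show "q \<in> (\<lambda>(p, u). p @ [u]) ` (SIGMA p:walks k. extensions p)"
    using ne(1) by (intro image_eqI[of _ _ "(butlast q, last q)"]) auto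
next
  fix q assume "q \<in> (\<lambda>(p, u). p @ [u]) ` (SIGMA p:walks k. extensions p)"
  then obtain p u where "q = p @ [u]" "p \<in> walks k" "u \<in> extensions p" by auto
  then show "q \<in> walks (Suc k)"
    using nonbacktracking_walk_snoc[of p u] by (force simp: walks_def)
qed

lemma finite_walks [simp]: "finite (walks k)"
  by (induction k) (auto simp: walks_0 walks_Suc)

text \<open>Splitting off the last vertex is a bijection, so a sum over walks can be evaluated one
  random step at a time.\<close>

lemma sum_walks_Suc:
  "(\<Sum>q\<in>walks (Suc k). h q) = (\<Sum>p\<in>walks k. \<Sum>u\<in>extensions p. h (p @ [u]))"
  for h :: "'a list \<Rightarrow> real"
proof -
  have "inj_on (\<lambda>(p, u). p @ [u]) (SIGMA p:walks k. extensions p)" by (auto simp: inj_on_def)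
  then show ?thesis
    by (simp add: walks_Suc sum.reindex sum.Sigma case_prod_unfold)
qed

lemma walks_Suc_nth:
  assumes "p \<in> walks (Suc k)"
  shows "last p = p ! Suc k" "p ! k \<in> V" "p ! Suc k \<in> V" "p ! k \<in> nbrs (p ! Suc k)"
    "extensions p = nbrs (p ! Suc k) - {p ! k}"
proof -
  have len: "length p = Suc (Suc k)" and sub: "set p \<subseteq> V" and e: "{p ! k, p ! Suc k} \<in> E"
    using assms by (auto simp: walks_def nonbacktracking_walk_def)
  show last: "last p = p ! Suc k" using len by (cases p) (auto simp: last_conv_nth)
  show "p ! k \<in> V" "p ! Suc k \<in> V" using len sub by (auto intro: subsetD[OF sub nth_mem])
  then show "p ! k \<in> nbrs (p ! Suc k)" using e by (simp add: nbrs_def insert_commute)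
  show "extensions p = nbrs (p ! Suc k) - {p ! k}" using last len by (auto simp: extensions_def)
qed

section \<open>Counting the continuations of a walk\<close>

lemma card_extensions_0: "p \<in> walks 0 \<Longrightarrow> card (extensions p) = d (last p)"
  by (auto simp: walks_0 extensions_def d_eq)

text \<open>The vertex just left is itself a neighbour of the last one, so exactly one neighbour is
  lost.\<close>

lemma card_extensions_Suc: "p \<in> walks (Suc k) \<Longrightarrow> card (extensions p) = d (last p) - 1"
  using walks_Suc_nth[of p k] by (simp add: d_eq)

lemma last_walk: "p \<in> walks k \<Longrightarrow> last p \<in> V"
  by (auto simp: walks_def nonbacktracking_walk_def)

lemma card_extensions_ge: "p \<in> walks k \<Longrightarrow> card (extensions p) \<ge> d (last p) - 1"
  by (cases k) (simp_all add: card_extensions_0 card_extensions_Suc)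

text \<open>Minimum degree 2 keeps the walk from getting stuck.\<close>

lemma card_extensions_pos: "p \<in> walks k \<Longrightarrow> card (extensions p) > 0"
  using card_extensions_ge[of p k] degree_ge_2[OF last_walk[of p k]] by linarith

section \<open>Weights of walks and stationarity\<close>

lemma weight_singleton [simp]: "weight [v] = real (d v)"
  by (simp add: weight_def)

lemma weight_nonneg: "weight p \<ge> 0"
  by (simp add: weight_def prod_nonneg)

lemma weight_snoc: "p \<noteq> [] \<Longrightarrow> weight (p @ [u]) = weight p / real (card (extensions p))"
proof -
  assume p: "p \<noteq> []"
  then obtain n where n: "length p = Suc n" by (cases p) auto
  then show ?thesis using p by (simp add: weight_def)
qed

lemma walk_nonempty: "p \<in> walks k \<Longrightarrow> p \<noteq> []"
  by (auto simp: walks_def)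

text \<open>One step of stationarity: a directed edge from \<open>b\<close> to \<open>u\<close> has
  exactly \<open>d b - 1\<close> predecessor edges, each passing on the share
  \<open>1 / (d b - 1)\<close>.\<close>

lemma sum_nbrs_nbrs:
  fixes h :: "'a \<Rightarrow> 'a \<Rightarrow> real"
  shows "(\<Sum>a\<in>V. \<Sum>b\<in>nbrs a. \<Sum>u\<in>nbrs b - {a}. h b u / (real (d b) - 1))
      = (\<Sum>b\<in>V. \<Sum>u\<in>nbrs b. h b u)"
proof -
  have "(\<Sum>a\<in>V. \<Sum>b\<in>nbrs a. \<Sum>u\<in>nbrs b - {a}. h b u / (real (d b) - 1))
      = (\<Sum>b\<in>V. \<Sum>a\<in>nbrs b. \<Sum>u\<in>nbrs b - {a}. h b u / (real (d b) - 1))"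
    by (rule sum_nbrs_swap)
  also have "\<dots> = (\<Sum>b\<in>V. \<Sum>u\<in>nbrs b. h b u)"
  proof (rule sum.cong)
    fix b assume b: "b \<in> V"
    have "(\<Sum>a\<in>nbrs b. \<Sum>u\<in>nbrs b - {a}. h b u / (real (d b) - 1))
        = (\<Sum>a\<in>nbrs b. \<Sum>u\<in>{u \<in> nbrs b. u \<noteq> a}. h b u / (real (d b) - 1))"
      by (intro sum.cong) auto
    \<comment> \<open>Swapping the sums counts the predecessors of a fixed outgoing edge instead of
      the successors of an incoming one.\<close>
    also have "\<dots> = (\<Sum>u\<in>nbrs b. \<Sum>a\<in>{a \<in> nbrs b. u \<noteq> a}. h b u / (real (d b) - 1))"
      by (rule sum.swap_restrict) auto
    also have "\<dots> = (\<Sum>u\<in>nbrs b. h b u)"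
    proof (rule sum.cong)
      fix u assume u: "u \<in> nbrs b"
      have "{a \<in> nbrs b. u \<noteq> a} = nbrs b - {u}" by auto
      then have "real (card {a \<in> nbrs b. u \<noteq> a}) = real (d b) - 1"
        using u degree_ge_2[OF b] by (simp add: d_eq of_nat_diff)
      then show "(\<Sum>a\<in>{a \<in> nbrs b. u \<noteq> a}. h b u / (real (d b) - 1)) = h b u"
        using degree_ge_2[OF b] by simp
    qed simp
    finally show "(\<Sum>a\<in>nbrs b. \<Sum>u\<in>nbrs b - {a}. h b u / (real (d b) - 1)) = (\<Sum>u\<in>nbrs b. h b u)" .
  qed simp
  finally show ?thesis .
qed

text \<open>The uniform distribution on directed edges is stationary for this walk.\<close>

lemma sum_weight_last_edge:
  fixes h :: "'a \<Rightarrow> 'a \<Rightarrow> real"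
  shows "(\<Sum>p\<in>walks (Suc k). weight p * h (p ! k) (p ! Suc k)) = (\<Sum>a\<in>V. \<Sum>b\<in>nbrs a. h a b)"
proof (induction k arbitrary: h)
  case 0
  have "(\<Sum>p\<in>walks (Suc 0). weight p * h (p ! 0) (p ! Suc 0))
      = (\<Sum>v\<in>V. \<Sum>u\<in>extensions [v]. weight ([v] @ [u]) * h v u)"
    by (simp add: sum_walks_Suc) (simp add: walks_0 sum.reindex inj_on_def)
  also have "\<dots> = (\<Sum>v\<in>V. \<Sum>u\<in>nbrs v. h v u)"
  proof (intro sum.cong)
    fix v u assume v: "v \<in> V"
    show extv: "extensions [v] = nbrs v" by (simp add: extensions_def)
    \<comment> \<open>The starting weight \<open>d v\<close> cancels the uniform choice among
      \<open>d v\<close> neighbours, so every directed edge receives weight 1.\<close>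
    have "weight ([v] @ [u]) = real (d v) / real (d v)"
      by (subst weight_snoc) (simp_all add: extv d_eq)
    then have "weight ([v] @ [u]) = 1" using degree_ge_2[OF v] by simp
    then show "weight ([v] @ [u]) * h v u = h v u" by simp
  qed simp
  finally show ?case .
next
  case (Suc k)
  \<comment> \<open>\<open>h' a b\<close> is the expected value of \<open>h\<close> on the edge that
    follows the edge from \<open>a\<close> to \<open>b\<close>; the induction is over arbitrary
    \<open>h\<close> so that it applies to \<open>h'\<close>.\<close>
  define h' where "h' a b = (\<Sum>u\<in>nbrs b - {a}. h b u / (real (d b) - 1))" for a b
  have "(\<Sum>p\<in>walks (Suc (Suc k)). weight p * h (p ! Suc k) (p ! Suc (Suc k)))
      = (\<Sum>p\<in>walks (Suc k). \<Sum>u\<in>extensions p.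
          weight (p @ [u]) * h ((p @ [u]) ! Suc k) ((p @ [u]) ! Suc (Suc k)))"
    by (rule sum_walks_Suc)
  also have "\<dots> = (\<Sum>p\<in>walks (Suc k). weight p * h' (p ! k) (p ! Suc k))"
    unfolding h'_def sum_distrib_left
  proof (intro sum.cong)
    fix p u assume p: "p \<in> walks (Suc k)"
    note w = walks_Suc_nth[OF p]
    show "extensions p = nbrs (p ! Suc k) - {p ! k}" by (rule w(5))
    have len: "length p = Suc (Suc k)" using p by (simp add: walks_def)
    have "weight (p @ [u]) = weight p / real (card (extensions p))"
      by (rule weight_snoc[OF walk_nonempty[OF p]])
    also have "real (card (extensions p)) = real (d (p ! Suc k)) - 1"
      using card_extensions_Suc[OF p] degree_ge_2[OF w(3)] w(1) by (simp add: of_nat_diff)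
    finally show "weight (p @ [u]) * h ((p @ [u]) ! Suc k) ((p @ [u]) ! Suc (Suc k))
        = weight p * (h (p ! Suc k) u / (real (d (p ! Suc k)) - 1))"
      by (simp add: nth_append len)
  qed simp
  also have "\<dots> = (\<Sum>a\<in>V. \<Sum>b\<in>nbrs a. h' a b)" by (rule Suc.IH)
  also have "\<dots> = (\<Sum>b\<in>V. \<Sum>u\<in>nbrs b. h b u)" unfolding h'_def by (rule sum_nbrs_nbrs)
  finally show ?case .
qed

text \<open>The vertex marginal of stationarity: at every time the endpoint is distributed
  proportionally to degree, since a vertex is the head of as many directed edges as its
  degree.\<close>

lemma sum_weight_last:
  fixes g :: "'a \<Rightarrow> real"
  shows "(\<Sum>p\<in>walks k. weight p * g (last p)) = (\<Sum>u\<in>V. real (d u) * g u)"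
proof (cases k)
  case 0
  then show ?thesis by (simp add: walks_0 sum.reindex inj_on_def)
next
  case (Suc m)
  have "(\<Sum>p\<in>walks k. weight p * g (last p))
      = (\<Sum>p\<in>walks (Suc m). weight p * g (p ! Suc m))"
    unfolding Suc by (intro sum.cong) (auto simp: walks_Suc_nth(1))
  also have "\<dots> = (\<Sum>a\<in>V. \<Sum>b\<in>nbrs a. g b)" by (rule sum_weight_last_edge[where h = "\<lambda>_ b. g b"])
  also have "\<dots> = (\<Sum>b\<in>V. \<Sum>a\<in>nbrs b. g b)" by (rule sum_nbrs_swap)
  finally show ?thesis by (simp add: d_eq)
qed

text \<open>If \<open>p\<close> has \<open>c\<close> continuations, each has weight
  \<open>weight p / c\<close>, so together they contribute \<open>weight p * sqrt c\<close>. Here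
  \<open>c\<close> is at least \<open>d (last p) - 1\<close>, and \<open>sum_weight_last\<close>
  evaluates the resulting sum.\<close>

lemma sum_sqrt_weight_ge:
  "(\<Sum>q\<in>walks (Suc k). sqrt (weight (butlast q)) * sqrt (weight q))
    \<ge> (\<Sum>u\<in>V. real (d u) * sqrt (real (d u) - 1))"
proof -
  have "(\<Sum>u\<in>V. real (d u) * sqrt (real (d u) - 1))
      = (\<Sum>p\<in>walks k. weight p * sqrt (real (d (last p)) - 1))"
    by (rule sum_weight_last[symmetric])
  also have "\<dots> \<le> (\<Sum>p\<in>walks k. \<Sum>u\<in>extensions p. sqrt (weight p) * sqrt (weight (p @ [u])))"
  proof (rule sum_mono)
    fix p assume p: "p \<in> walks k"
    define c where "c = real (card (extensions p))"
    have c: "c > 0" using card_extensions_pos[OF p] by (simp add: c_def)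
    have "real (d (last p)) - 1 \<le> c"
      using card_extensions_ge[OF p] by (simp add: c_def)
    then have "weight p * sqrt (real (d (last p)) - 1) \<le> weight p * sqrt c"
      by (intro mult_left_mono) (auto simp: weight_nonneg)
    also have "\<dots> = c * (sqrt (weight p) * sqrt (weight p / c))"
      using c weight_nonneg[of p] by (simp add: real_sqrt_divide real_div_sqrt field_simps)
    also have "\<dots> = (\<Sum>u\<in>extensions p. sqrt (weight p) * sqrt (weight (p @ [u])))"
      by (simp add: weight_snoc[OF walk_nonempty[OF p]] c_def)
    finally show "weight p * sqrt (real (d (last p)) - 1)
        \<le> (\<Sum>u\<in>extensions p. sqrt (weight p) * sqrt (weight (p @ [u])))" .
  qed
  also have "\<dots> = (\<Sum>q\<in>walks (Suc k). sqrt (weight (butlast q)) * sqrt (weight q))"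
    by (simp add: sum_walks_Suc)
  finally show ?thesis .
qed

subsection \<open>Averaging over the unraveled balls\<close>

definition walks_from :: "nat \<Rightarrow> 'a \<Rightarrow> 'a list set" where
  "walks_from r v = {p. nonbacktracking_walk (V, E) p \<and> hd p = v \<and> length p \<le> r + 1}"

lemma walks_atMost:
  "(\<Union>k\<le>r. walks k) = {p. nonbacktracking_walk (V, E) p \<and> length p \<le> r + 1}"
proof (intro equalityI subsetI)
  fix p assume p: "p \<in> {p. nonbacktracking_walk (V, E) p \<and> length p \<le> r + 1}"
  then have "length p \<noteq> 0" by (simp add: nonbacktracking_walk_def)
  with p have "p \<in> walks (length p - 1)" "length p - 1 \<le> r" by (auto simp: walks_def)
  then show "p \<in> (\<Union>k\<le>r. walks k)" by blast
qed (auto simp: walks_def)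

lemma finite_walks_from: "finite (walks_from r v)"
proof (rule finite_subset)
  show "walks_from r v \<subseteq> (\<Union>k\<le>r. walks k)" unfolding walks_atMost by (auto simp: walks_from_def)
qed simp

text \<open>Each walk of length at most \<open>r\<close> lies in exactly one ball, the one centred
  at its first vertex.\<close>

lemma sum_walks_from:
  "(\<Sum>v\<in>V. \<Sum>p\<in>walks_from r v. h p) = (\<Sum>k\<le>r. \<Sum>p\<in>walks k. h p)" for h :: "'a list \<Rightarrow> real"
proof -
  define S where "S = (\<Union>k\<le>r. walks k)"
  have "finite S" by (simp add: S_def)
  have "hd ` S \<subseteq> V"
    by (auto simp: S_def walks_def nonbacktracking_walk_def)
  then have "(\<Sum>v\<in>V. \<Sum>p\<in>{p \<in> S. hd p = v}. h p) = sum h S"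
    using \<open>finite S\<close> by (intro sum.group) auto
  moreover have "{p \<in> S. hd p = v} = walks_from r v" for v
    by (auto simp: S_def walks_atMost walks_from_def)
  moreover have "sum h S = (\<Sum>k\<le>r. \<Sum>p\<in>walks k. h p)"
    unfolding S_def by (rule sum.UNION_disjoint) (simp, simp, auto simp: walks_def)
  ultimately show ?thesis by simp
qed

text \<open>The ball is a rooted tree: each walk except the root has the parent
  \<open>butlast q\<close>, and its edge to the parent occurs as two ordered pairs.\<close>

lemma sum_unraveled_ball_adjacent:
  fixes f :: "'a list \<Rightarrow> real" and r :: nat
  defines "H v \<equiv> unraveled_ball (V, E) v r"
  shows "(\<Sum>(x, y)\<in>{(x, y). x \<in> fst (H v) \<and> y \<in> fst (H v) \<and> {x, y} \<in> snd (H v)}. f x * f y)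
    = (\<Sum>q\<in>walks_from r v. if length q \<ge> 2 then 2 * (f (butlast q) * f q) else 0)"
proof -
  define D where "D = {q \<in> walks_from r v. length q \<ge> 2}"
  have finD: "finite D" using finite_walks_from by (simp add: D_def)
  have H: "fst (H v) = walks_from r v"
    "snd (H v) = {{p, p @ [u]} | p u. p \<in> walks_from r v \<and> p @ [u] \<in> walks_from r v}"
    by (simp_all add: H_def unraveled_ball_def Let_def walks_from_def)
  have D: "q \<noteq> []" "butlast q \<in> walks_from r v" if "q \<in> D" for q
  proof -
    show ne: "q \<noteq> []" using that by (auto simp: D_def)
    have ne': "butlast q \<noteq> []" using that by (auto simp: D_def butlast_conv_take)
    have q: "q = butlast q @ [last q]" using ne by simp
    have "nonbacktracking_walk (V, E) (butlast q @ [last q])"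
      using that ne by (simp add: D_def walks_from_def)
    then have "nonbacktracking_walk (V, E) (butlast q)"
      using nonbacktracking_walk_snoc[OF ne'] by blast
    moreover have "hd (butlast q) = hd q"
      using ne' by (subst (2) q) simp
    ultimately show "butlast q \<in> walks_from r v" using that by (auto simp: D_def walks_from_def)
  qed
  have snoc: "p @ [u] \<in> D" if "p \<in> walks_from r v" "p @ [u] \<in> walks_from r v" for p u
    using that by (cases p) (auto simp: D_def walks_from_def nonbacktracking_walk_def)
  have adj: "{(x, y). x \<in> fst (H v) \<and> y \<in> fst (H v) \<and> {x, y} \<in> snd (H v)}
      = (\<lambda>q. (butlast q, q)) ` D \<union> (\<lambda>q. (q, butlast q)) ` D" (is "?L = ?A \<union> ?B")
  proof (intro equalityI subsetI)
    fix z assume "z \<in> ?L"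
    then obtain x y where xy: "z = (x, y)" "{x, y} \<in> snd (H v)" by auto
    from xy(2) obtain p u where z: "{x, y} = {p, p @ [u]}"
      and pu: "p \<in> walks_from r v" "p @ [u] \<in> walks_from r v"
      unfolding H by auto
    from z consider "x = p" "y = p @ [u]" | "y = p" "x = p @ [u]" by (auto simp: doubleton_eq_iff)
    then show "z \<in> ?A \<union> ?B"
    proof cases
      case 1
      then have "z = (butlast (p @ [u]), p @ [u])" using xy(1) by simp
      then show ?thesis using snoc[OF pu] by blast
    next
      case 2
      then have "z = (p @ [u], butlast (p @ [u]))" using xy(1) by simp
      then show ?thesis using snoc[OF pu] by blast
    qed
  next
    fix z assume "z \<in> ?A \<union> ?B"
    then obtain q where q: "q \<in> D" "z = (butlast q, q) \<or> z = (q, butlast q)" by blast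
    have "butlast q @ [last q] \<in> walks_from r v"
      using D(1)[OF q(1)] q(1) by (simp add: D_def)
    then have "{butlast q, butlast q @ [last q]} \<in> snd (H v)"
      unfolding H using D(2)[OF q(1)] by blast
    then have "{butlast q, q} \<in> snd (H v)" using D(1)[OF q(1)] by simp
    moreover have "q \<in> fst (H v)" "butlast q \<in> fst (H v)"
      using q(1) D(2) by (simp_all add: H D_def)
    ultimately show "z \<in> ?L" using q(2) by (auto simp: insert_commute)
  qed
  \<comment> \<open>A pair in both sets would have each entry shorter than the other.\<close>
  have "?A \<inter> ?B = {}"
  proof -
    have False if "q \<in> D" "q' \<in> D" "butlast q = q'" "q = butlast q'" for q q'
    proof -
      have "length q = length q - 1 - 1" using that(3,4) by (metis length_butlast)
      then show False using D(1)[OF that(1)] by (cases q) auto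
    qed
    then show ?thesis by blast
  qed
  then have "(\<Sum>(x, y)\<in>?L. f x * f y) = (\<Sum>(x, y)\<in>?A. f x * f y) + (\<Sum>(x, y)\<in>?B. f x * f y)"
    unfolding adj using finD by (intro sum.union_disjoint) auto
  also have "\<dots> = (\<Sum>q\<in>D. f (butlast q) * f q) + (\<Sum>q\<in>D. f q * f (butlast q))"
    by (simp add: sum.reindex inj_on_def)
  also have "\<dots> = (\<Sum>q\<in>D. 2 * (f (butlast q) * f q))"
    by (simp add: sum.distrib[symmetric] mult.commute)
  also have "\<dots> = (\<Sum>q\<in>walks_from r v. if length q \<ge> 2 then 2 * (f (butlast q) * f q) else 0)"
    unfolding D_def by (rule sum.inter_filter[OF finite_walks_from])
  finally show ?thesis .
qed

lemma exists_unraveled_ball_lambda1_ge: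
  "\<exists>v\<in>V. lambda1 (unraveled_ball (V, E) v r) \<ge>
    1 / real (card E) * (\<Sum>u\<in>V. real (d u) * sqrt (real (d u) - 1)) * cos (pi / (real r + 2))"
proof -
  define t where "t = pi / (real r + 2)"
  define s where "s j = sin (real j * t)" for j :: nat
  \<comment> \<open>A walk of length \<open>k\<close> has \<open>k + 1\<close> entries, so
    \<open>length p\<close> is already the sine index; the zeros at 0 and \<open>r + 2\<close> lie
    just outside the ball.\<close>
  define f where "f p = s (length p) * sqrt (weight p)" for p
  define S where "S = (\<Sum>u\<in>V. real (d u) * sqrt (real (d u) - 1))"
  define P where "P = (\<Sum>k\<le>r. (s (k + 1))\<^sup>2)"
  define c where "c = 1 / real (card E) * S * cos t"
  define N where "N v = (\<Sum>p\<in>walks_from r v. (f p)\<^sup>2)" for v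
  define Q where "Q v = (\<Sum>q\<in>walks_from r v. if length q \<ge> 2 then 2 * (f (butlast q) * f q) else 0)" for v
  \<comment> \<open>The angles stay between 0 and \<open>pi\<close>, so products of these sines may
    multiply the bound \<open>sum_sqrt_weight_ge\<close>.\<close>
  have s_nonneg: "s j \<ge> 0" if "j \<le> r + 2" for j
  proof -
    have "real j * t \<le> (real r + 2) * t"
      unfolding t_def using that by (intro mult_right_mono) auto
    also have "\<dots> = pi" by (simp add: t_def add_pos_nonneg)
    finally show ?thesis unfolding s_def by (intro sin_ge_zero) (auto simp: t_def)
  qed
  have s1: "s 1 > 0"
    unfolding s_def by (intro sin_gt_zero) (auto simp: t_def field_simps add_pos_nonneg)
  have "(\<Sum>v\<in>V. real (d v)) > 0"
    using V_nonempty degree_ge_2 by (intro sum_pos) force+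
  then have cardE: "card E > 0" using sum_degrees by simp
  have sumN: "(\<Sum>v\<in>V. N v) = 2 * real (card E) * P"
  proof -
    have "(\<Sum>v\<in>V. N v) = (\<Sum>k\<le>r. \<Sum>p\<in>walks k. (f p)\<^sup>2)" unfolding N_def by (rule sum_walks_from)
    \<comment> \<open>The squared sine depends only on the length, and the walks of each length have
      the same total weight, the degree sum.\<close>
    also have "\<dots> = (\<Sum>k\<le>r. (s (k + 1))\<^sup>2 * (\<Sum>p\<in>walks k. weight p * 1))"
      unfolding sum_distrib_left
      by (intro sum.cong) (auto simp: f_def walks_def power_mult_distrib weight_nonneg)
    also have "\<dots> = P * (2 * real (card E))"
      unfolding sum_weight_last[of "\<lambda>_. 1"] P_def by (simp add: sum_degrees sum_distrib_right)
    finally show ?thesis by simp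
  qed
  have "2 * cos t * P * S = (\<Sum>k<r. 2 * (s (k + 1) * s (k + 2)) * S)"
    unfolding sum_distrib_right[symmetric]
    using sin_path_eigenvector[of r] by (simp only: P_def s_def t_def)
  also have "\<dots> \<le> (\<Sum>k<r. 2 * (s (k + 1) * s (k + 2))
      * (\<Sum>q\<in>walks (Suc k). sqrt (weight (butlast q)) * sqrt (weight q)))"
    unfolding S_def using s_nonneg
    by (intro sum_mono mult_left_mono sum_sqrt_weight_ge) auto
  also have "\<dots> = (\<Sum>k<r. \<Sum>q\<in>walks (Suc k). if length q \<ge> 2 then 2 * (f (butlast q) * f q) else 0)"
    unfolding sum_distrib_left by (intro sum.cong) (auto simp: f_def walks_def)
  \<comment> \<open>The added walks of length 0 are the roots, which have no parent and contribute
    0.\<close>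
  also have "\<dots> = (\<Sum>k\<le>r. \<Sum>q\<in>walks k. if length q \<ge> 2 then 2 * (f (butlast q) * f q) else 0)"
    by (subst sum.atMost_shift) (simp add: walks_0 sum.reindex inj_on_def)
  also have "\<dots> = (\<Sum>v\<in>V. Q v)" unfolding Q_def by (rule sum_walks_from[symmetric])
  also have "2 * cos t * P * S = c * (\<Sum>v\<in>V. N v)"
    using cardE by (simp add: sumN c_def)
  finally have "(\<Sum>v\<in>V. c * N v) \<le> (\<Sum>v\<in>V. Q v)"
    by (simp only: sum_distrib_left)
  \<comment> \<open>If \<open>Q v < c * N v\<close> held at every centre, summing would contradict
    the averaged inequality.\<close>
  then obtain v where v: "v \<in> V" "c * N v \<le> Q v"
    using V_nonempty sum_strict_mono[OF finite_V, of Q "\<lambda>v. c * N v"] by (meson not_le)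
  have fst_ball: "fst (unraveled_ball (V, E) v r) = walks_from r v"
    by (simp add: unraveled_ball_def Let_def walks_from_def)
  note adjacent = sum_unraveled_ball_adjacent[where v = v and r = r and f = f, unfolded fst_ball]
  \<comment> \<open>The root entry alone makes the test function nonzero, as the Rayleigh bound
    requires.\<close>
  have "(f [v])\<^sup>2 > 0" using s1 degree_ge_2[OF v(1)] by (simp add: f_def)
  also have "(f [v])\<^sup>2 \<le> N v"
    unfolding N_def using v(1)
    by (intro member_le_sum finite_walks_from)
      (auto simp: walks_from_def nonbacktracking_walk_def)
  finally have "c \<le> lambda1 (unraveled_ball (V, E) v r)"
    using v(2) finite_walks_from
    by (intro lambda1_ge_Rayleigh_quotient[of _ f])
      (simp_all only: adjacent fst_ball N_def Q_def)
  then show ?thesis using v(1) by (auto simp: c_def S_def t_def)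
qed

end

theorem theorem1:
  fixes V :: "'a set" and E :: "'a set set" and r :: nat
  assumes "finite_simple_graph (V, E)"
    and "\<And>u. u \<in> V \<Longrightarrow> vertex_degree (V, E) u \<ge> 2"
  shows "\<exists>v\<in>V. lambda1 (unraveled_ball (V, E) v r) \<ge>
    1 / real (card E) *
      (\<Sum>u\<in>V. real (vertex_degree (V, E) u) * sqrt (real (vertex_degree (V, E) u) - 1)) *
      cos (pi / (real r + 2))"
proof -
  interpret min_degree_2_graph V E using assms by unfold_locales
  show ?thesis by (rule exists_unraveled_ball_lambda1_ge)
qed

end
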